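(* On a uniform grid, every subdivision scheme of the family given by the rules $$z^{k+1}_{\boldsymbol\ell}=\sum_{\mathbf i\in\mathcal B^{k+1,\boldsymbol\ell}}\alpha^{k+1,\boldsymbol\ell}_{\mathbf i}\,z^k_{\mathbf i},\qquad \alpha^{k+1,\boldsymbol\ell}_{\mathbf i}=\frac{w^{k+1,\boldsymbol\ell}_{\mathbf i}}{\sum_{\mathbf j\in\mathcal B^{k+1,\boldsymbol\ell}}w^{k+1,\boldsymbol\ell}_{\mathbf j}},\qquad k\ge 0,\ \boldsymbol\ell\in\mathbb Z^2,$$ is uniformly convergent: for every initial data set $\mathbf z^0=\{z^0_{\boldsymbol\ell}\}_{\boldsymbol\ell\in\mathbb Z^2}\subset\mathbb R$ there exists a continuous function $F:\mathbb R^2\to\mathbb R$ (the limit function) such that $$\lim_{k\to\infty}\ \sup_{\boldsymbol\ell\in\mathbb Z^2}\left|z^k_{\boldsymbol\ell}-F(\mathbf v^k_{\boldsymbol\ell})\right|=0 .$$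
   Context: Uniform grid: let $\mathbf e^1,\mathbf e^2\in\mathbb R^2$ be linearly independent. The initial triangulation is the image, under the invertible linear map with matrix $[\mathbf e^1,\mathbf e^2]$, of the triangular-rectangular grid (vertices $\mathbb Z^2$, edges joining $\mathbf m$ to $\mathbf m+(1,0)$, $\mathbf m+(0,1)$ and $\mathbf m+(1,1)$). It is refined repeatedly by adding the mid-points of all edges, so the level-$k$ vertices are $\mathbf v^k_{\boldsymbol\ell}=2^{-k}\ell_1\mathbf e^1+2^{-k}\ell_2\mathbf e^2$, $\boldsymbol\ell=(\ell_1,\ell_2)\in\mathbb Z^2$, $k\ge 0$. A scheme of the family is fixed by a real number $L$ larger than the length of every edge of the initial triangulation, i.e. $L>\max\{\|\mathbf e^1\|,\|\mathbf e^2\|,\|\mathbf e^1+\mathbf e^2\|\}$ ($\|\cdot\|$ is the Euclidean norm), and a weight function $W:[0,1)\to(0,1]$. For $k\ge 0$ and $\boldsymbol\ell\in\mathbb Z^2$ the $L$-ball (stencil) and the weights are $$\mathcal B^{k+1,\boldsymbol\ell}=\{\mathbf i\in\mathbb Z^2:\ \|\mathbf v^{k+1}_{\boldsymbol\ell}-\mathbf v^k_{\mathbf i}\|<2^{-k}L\},\qquad w^{k+1,\boldsymbol\ell}_{\mathbf i}=W\!\left(\frac{\|\mathbf v^{k+1}_{\boldsymbol\ell}-\mathbf v^k_{\mathbf i}\|}{2^{-k}L}\right),\ \mathbf i\in\mathcal B^{k+1,\boldsymbol\ell}.$$ The sequence $\mathbf z^k=\{z^k_{\boldsymbol\ell}\}_{\boldsymbol\ell\in\mathbb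 Z^2}$, $k\ge1$, is obtained from $\mathbf z^0$ by applying the rules level by level.
   Formalization: For arbitrary initial data the supremum over all of Z^2 can be infinite at infinitely many levels; it is shown to tend to 0 when differences of z^0 along initial edges are bounded (e.g. bounded data), and for every z^0 with the supremum over the vertices in any compact set. *)

theory Defs
  imports "HOL-Analysis.Analysis"
begin

definition grid_vertex :: "real^2 \<Rightarrow> real^2 \<Rightarrow> nat \<Rightarrow> int \<times> int \<Rightarrow> real^2" where
  "grid_vertex e1 e2 k l =
     ((1/2)^k * real_of_int (fst l)) *\<^sub>R e1 + ((1/2)^k * real_of_int (snd l)) *\<^sub>R e2"

text \<open>The stencil and the weight used for the vertex with index \<open>l\<close> of level \<open>k + 1\<close>;
  the argument \<open>k\<close> is the coarser of the two levels.\<close>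

definition stencil :: "real^2 \<Rightarrow> real^2 \<Rightarrow> real \<Rightarrow> nat \<Rightarrow> int \<times> int \<Rightarrow> (int \<times> int) set" where
  "stencil e1 e2 L k l =
     {i. norm (grid_vertex e1 e2 (Suc k) l - grid_vertex e1 e2 k i) < (1/2)^k * L}"

definition stencil_weight ::
  "real^2 \<Rightarrow> real^2 \<Rightarrow> real \<Rightarrow> (real \<Rightarrow> real) \<Rightarrow> nat \<Rightarrow> int \<times> int \<Rightarrow> int \<times> int \<Rightarrow> real" where
  "stencil_weight e1 e2 L W k l i =
     W (norm (grid_vertex e1 e2 (Suc k) l - grid_vertex e1 e2 k i) / ((1/2)^k * L))"

definition subdiv_coeff ::
  "real^2 \<Rightarrow> real^2 \<Rightarrow> real \<Rightarrow> (real \<Rightarrow> real) \<Rightarrow> nat \<Rightarrow> int \<times> int \<Rightarrow> int \<times> int \<Rightarrow> real" where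
  "subdiv_coeff e1 e2 L W k l i =
     stencil_weight e1 e2 L W k l i / (\<Sum>j\<in>stencil e1 e2 L k l. stencil_weight e1 e2 L W k l j)"

primrec subdiv_data ::
  "real^2 \<Rightarrow> real^2 \<Rightarrow> real \<Rightarrow> (real \<Rightarrow> real) \<Rightarrow> (int \<times> int \<Rightarrow> real) \<Rightarrow> nat \<Rightarrow> int \<times> int \<Rightarrow> real"
where
  "subdiv_data e1 e2 L W z0 0 = z0"
| "subdiv_data e1 e2 L W z0 (Suc k) =
     (\<lambda>l. \<Sum>i\<in>stencil e1 e2 L k l. subdiv_coeff e1 e2 L W k l i * subdiv_data e1 e2 L W z0 k i)"

text \<open>The supremum is taken in \<open>[0,\<infinity>]\<close>, so that an unbounded deviation counts as \<open>\<infinity>\<close>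
  (and the supremum over an empty set of indices as \<open>0\<close>).\<close>

definition sup_deviation ::
  "real^2 \<Rightarrow> real^2 \<Rightarrow> (int \<times> int \<Rightarrow> real) \<Rightarrow> (real^2 \<Rightarrow> real) \<Rightarrow> nat \<Rightarrow> (int \<times> int) set \<Rightarrow> ennreal"
where
  "sup_deviation e1 e2 z F k A = (SUP l\<in>A. ennreal \<bar>z l - F (grid_vertex e1 e2 k l)\<bar>)"

text \<open>Data whose differences along the edges of the initial triangulation are bounded;
  this includes all bounded data. For data of faster growth the supremum of the deviation over
  the whole grid can be infinite at infinitely many levels, and convergence is uniform on compact
  sets only.\<close>

definition bounded_edge_differences :: "(int \<times> int \<Rightarrow> real) \<Rightarrow> bool" where
  "bounded_edge_differences z \<longleftrightarrow>
     (\<exists>M. \<forall>l. \<forall>d\<in>{(1,0), (0,1), (1,1)}. \<bar>z (l + d) - z l\<bar> \<le> M)"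

lemma bounded_imp_bounded_edge_differences:
  assumes "bounded (range z)"
  shows "bounded_edge_differences z"
proof -
  obtain B where B: "\<And>l. \<bar>z l\<bar> \<le> B"
    using assms by (auto simp: bounded_iff)
  have "\<bar>z m - z l\<bar> \<le> 2 * B" for m l
    using B[of m] B[of l] by linarith
  then show ?thesis
    unfolding bounded_edge_differences_def by blast
qed

text \<open>The sums above range over finite sets.\<close>

lemma finite_stencil:
  assumes "independent {e1, e2}" and "e1 \<noteq> e2"
  shows "finite (stencil e1 e2 L k l)"
proof -
  let ?f = "\<lambda>p::real \<times> real. fst p *\<^sub>R e1 + snd p *\<^sub>R e2"
  have lin: "linear ?f"
    by (rule linearI) (auto simp: algebra_simps)
  have inj: "inj ?f"
  proof (subst linear_injective_0[OF lin], intro allI impI)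
    fix p :: "real \<times> real" assume p: "?f p = 0"
    let ?u = "\<lambda>v. if v = e1 then fst p else snd p"
    have "(\<Sum>v\<in>{e1, e2}. ?u v *\<^sub>R v) = 0"
      using p assms(2) by auto
    then have "\<forall>v\<in>{e1, e2}. ?u v = 0"
      using independentD[OF assms(1), of "{e1, e2}" ?u] by blast
    then show "p = 0"
      using assms(2) by (auto simp: prod_eq_iff split: if_splits)
  qed
  obtain B where B: "B > 0" "\<And>p. B * norm p \<le> norm (?f p)"
    using linear_inj_bounded_below_pos[OF lin inj] by blast
  define C where "C = (norm (grid_vertex e1 e2 (Suc k) l) + (1/2)^k * L) / (B * (1/2)^k)"
  have "stencil e1 e2 L k l \<subseteq> {- \<lceil>C\<rceil>..\<lceil>C\<rceil>} \<times> {- \<lceil>C\<rceil>..\<lceil>C\<rceil>}"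
  proof
    fix i assume i: "i \<in> stencil e1 e2 L k l"
    let ?p = "((1/2)^k * real_of_int (fst i), (1/2)^k * real_of_int (snd i)) :: real \<times> real"
    have "norm (grid_vertex e1 e2 k i) < norm (grid_vertex e1 e2 (Suc k) l) + (1/2)^k * L"
      using i norm_triangle_ineq3[of "grid_vertex e1 e2 (Suc k) l" "grid_vertex e1 e2 k i"]
      by (auto simp: stencil_def)
    moreover have "B * norm ?p \<le> norm (grid_vertex e1 e2 k i)"
      using B(2)[of ?p] by (simp add: grid_vertex_def)
    ultimately have *: "B * norm ?p \<le> C * (B * (1/2)^k)"
      using B(1) by (simp add: C_def)
    have "\<bar>fst ?p\<bar> \<le> norm ?p" "\<bar>snd ?p\<bar> \<le> norm ?p"
      using norm_fst_le[of "fst ?p" "snd ?p"] norm_snd_le[of "snd ?p" "fst ?p"] by auto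
    then have "B * \<bar>fst ?p\<bar> \<le> B * norm ?p" "B * \<bar>snd ?p\<bar> \<le> B * norm ?p"
      using B(1) by (simp_all only: mult_le_cancel_left_pos)
    then have "B * \<bar>fst ?p\<bar> \<le> C * (B * (1/2)^k)" "B * \<bar>snd ?p\<bar> \<le> C * (B * (1/2)^k)"
      using * by linarith+
    then have "\<bar>real_of_int (fst i)\<bar> \<le> C" "\<bar>real_of_int (snd i)\<bar> \<le> C"
      using B(1) by (auto simp: abs_mult field_simps)
    then have "\<bar>fst i\<bar> \<le> \<lceil>C\<rceil>" "\<bar>snd i\<bar> \<le> \<lceil>C\<rceil>"
      by linarith+
    then show "i \<in> {- \<lceil>C\<rceil>..\<lceil>C\<rceil>} \<times> {- \<lceil>C\<rceil>..\<lceil>C\<rceil>}"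
      by (auto simp: mem_Times_iff)
  qed
  then show ?thesis
    by (rule finite_subset) auto
qed

end

(* Each value of the next level is a convex combination of values of the current one, with weights
   bounded below by a positive constant on the indices i with |l - 2 i| <= 1 (maximum norm). Coupling
   the averages for two indices l, m independently, one may with probability bounded below replace
   (l, m) by (l div 2, m div 2), which halves their distance, and once the distance is at most 1 the
   two indices have a common such i. Since stencils have bounded size in grid units, the oscillation
   over pairs within a fixed distance therefore contracts by a constant factor every few levels, and
   the piecewise constant interpolants form a geometric Cauchy sequence. Only values in a
   dependency-closed family of index sets matter: taking all indices gives the global statement,
   taking slightly enlarged balls gives the statement on compact sets. *)

theory Submission
  imports Defs
begin

section \<open>Index arithmetic between consecutive levels\<close>

definition cheb :: "int \<times> int \<Rightarrow> int \<times> int \<Rightarrow> int" where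
  "cheb l m = max \<bar>fst l - fst m\<bar> \<bar>snd l - snd m\<bar>"

definition dbl :: "int \<times> int \<Rightarrow> int \<times> int" where
  "dbl i = (2 * fst i, 2 * snd i)"

lemma cheb_le_iff: "cheb l m \<le> r \<longleftrightarrow> \<bar>fst l - fst m\<bar> \<le> r \<and> \<bar>snd l - snd m\<bar> \<le> r"
  by (simp add: cheb_def)

text \<open>Of \<open>max a b\<close> and \<open>max a b - 1\<close> one is even, and it is within 1
  of both \<open>a\<close> and \<open>b\<close>. Rounding down the minimum could fail when it is
  odd.\<close>

lemma cheb_le_1_common_parent:
  assumes "cheb l m \<le> 1"
  shows "\<exists>i. cheb l (dbl i) \<le> 1 \<and> cheb m (dbl i) \<le> 1"
proof -
  have *: "\<bar>a - 2 * (max a b div 2)\<bar> \<le> 1 \<and> \<bar>b - 2 * (max a b div 2)\<bar> \<le> 1"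
    if "\<bar>a - b\<bar> \<le> 1" for a b :: int
    using that unfolding max_def by (cases "a \<le> b") (simp_all, presburger+)
  show ?thesis
    using assms
    by (intro exI[of _ "(max (fst l) (fst m) div 2, max (snd l) (snd m) div 2)"])
      (simp add: cheb_le_iff dbl_def *)
qed

text \<open>The witnesses are the componentwise halves: \<open>div 2\<close> is monotone and turns a
  shift by \<open>2 * r\<close> into one by \<open>r\<close>.\<close>

lemma cheb_halving:
  assumes "cheb l m \<le> 2 * r"
  shows "\<exists>i i'. cheb l (dbl i) \<le> 1 \<and> cheb m (dbl i') \<le> 1 \<and> cheb i i' \<le> r"
proof -
  have 1: "\<bar>a - 2 * (a div 2)\<bar> \<le> 1" for a :: int by presburger
  have 2: "\<bar>a div 2 - b div 2\<bar> \<le> r" if "\<bar>a - b\<bar> \<le> 2 * r" for a b :: int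
    using that by presburger
  show ?thesis
    using assms
    by (simp only: cheb_le_iff dbl_def split_paired_Ex fst_conv snd_conv) (blast intro: 1 2)
qed

section \<open>Convex combinations and geometric increments\<close>

text \<open>Under the product weights on \<open>A \<times> B\<close> the difference of the averages
  is an average of the differences \<open>x i - y j\<close>, in which the pair
  \<open>(i0, j0)\<close> has weight at least \<open>\<delta>\<close>.\<close>

lemma product_coupling:
  fixes x y \<alpha> \<beta> :: "'a \<Rightarrow> real"
  assumes fin: "finite A" "finite B"
    and nonneg: "\<And>i. i \<in> A \<Longrightarrow> 0 \<le> \<alpha> i" "\<And>j. j \<in> B \<Longrightarrow> 0 \<le> \<beta> j"
    and sums: "sum \<alpha> A = 1" "sum \<beta> B = 1"
    and le: "\<And>i j. i \<in> A \<Longrightarrow> j \<in> B \<Longrightarrow> \<bar>x i - y j\<bar> \<le> D"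
    and good: "i0 \<in> A" "j0 \<in> B" "\<bar>x i0 - y j0\<bar> \<le> D0" "D0 \<le> D" "\<delta> \<le> \<alpha> i0 * \<beta> j0"
  shows "\<bar>(\<Sum>i\<in>A. \<alpha> i * x i) - (\<Sum>j\<in>B. \<beta> j * y j)\<bar> \<le> \<delta> * D0 + (1 - \<delta>) * D"
proof -
  let ?w = "\<lambda>p. \<alpha> (fst p) * \<beta> (snd p)"
  let ?p0 = "(i0, j0)"
  have w: "sum ?w (A \<times> B) = 1"
    using sums by (simp add: sum.cartesian_product' sum_product[symmetric])
  have x: "(\<Sum>i\<in>A. \<alpha> i * x i) = (\<Sum>p\<in>A \<times> B. ?w p * x (fst p))"
  proof -
    have "(\<Sum>i\<in>A. \<alpha> i * x i) = (\<Sum>i\<in>A. \<alpha> i * x i) * sum \<beta> B" using sums by simp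
    also have "\<dots> = (\<Sum>p\<in>A \<times> B. ?w p * x (fst p))"
      unfolding sum_product by (simp add: sum.cartesian_product' mult_ac)
    finally show ?thesis .
  qed
  have y: "(\<Sum>j\<in>B. \<beta> j * y j) = (\<Sum>p\<in>A \<times> B. ?w p * y (snd p))"
  proof -
    have "(\<Sum>j\<in>B. \<beta> j * y j) = sum \<alpha> A * (\<Sum>j\<in>B. \<beta> j * y j)" using sums by simp
    also have "\<dots> = (\<Sum>p\<in>A \<times> B. ?w p * y (snd p))"
      unfolding sum_product by (simp add: sum.cartesian_product' mult_ac)
    finally show ?thesis .
  qed
  have "\<bar>(\<Sum>i\<in>A. \<alpha> i * x i) - (\<Sum>j\<in>B. \<beta> j * y j)\<bar>
      = \<bar>\<Sum>p\<in>A \<times> B. ?w p * (x (fst p) - y (snd p))\<bar>"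
    unfolding x y by (simp add: sum_subtractf algebra_simps)
  also have "\<dots> \<le> (\<Sum>p\<in>A \<times> B. ?w p * \<bar>x (fst p) - y (snd p)\<bar>)"
    by (rule order_trans[OF sum_abs], rule sum_mono) (auto simp: abs_mult nonneg)
  also have "\<dots> \<le> (\<Sum>p\<in>A \<times> B. ?w p * (if p = ?p0 then D0 else D))"
    by (rule sum_mono) (auto intro!: mult_left_mono simp: nonneg le good)
  also have "\<dots> = (\<Sum>p\<in>A \<times> B. ?w p * D - (if p = ?p0 then ?w p * (D - D0) else 0))"
    by (rule sum.cong) (auto simp: algebra_simps)
  also have "\<dots> = D - ?w ?p0 * (D - D0)"
    using fin good w by (simp add: sum_subtractf sum.delta sum_distrib_right[symmetric])
  \<comment> \<open>As \<open>D0 \<le> D\<close>, lowering the weight of the good pair to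
    \<open>\<delta>\<close> can only enlarge the bound.\<close>
  also have "\<dots> \<le> D - \<delta> * (D - D0)"
    using mult_right_mono[OF good(5), of "D - D0"] good(4) by simp
  finally show ?thesis by (simp add: algebra_simps)
qed

lemma geometric_increments_limit:
  fixes s :: "nat \<Rightarrow> real"
  assumes q: "0 \<le> q" "q < 1" and step: "\<And>k. \<bar>s (Suc k) - s k\<bar> \<le> C * q ^ k"
  shows "\<bar>lim s - s k\<bar> \<le> C / (1 - q) * q ^ k"
proof -
  define d where "d = (\<lambda>i. s (Suc i) - s i)"
  have geo: "(\<lambda>i. C * q ^ i) sums (C * (1 / (1 - q)))"
    using geometric_sums[of q] q by (intro sums_mult) auto
  have d: "summable d"
    by (rule summable_comparison_test[OF _ sums_summable[OF geo]])
      (use step in \<open>auto simp: d_def\<close>)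
  have "(\<lambda>i. s i - s 0) \<longlonglongrightarrow> suminf d"
    using summable_LIMSEQ[OF d] by (simp add: d_def sum_lessThan_telescope)
  then have "s \<longlonglongrightarrow> suminf d + s 0"
    using tendsto_add[OF _ tendsto_const[of "s 0"]] by fastforce
  then have conv: "s \<longlonglongrightarrow> lim s" by (simp add: limI)
  \<comment> \<open>The factor \<open>1 - q ^ n\<close> comes from the exact geometric sum, so the
    induction closes with an equality; it is dropped afterwards.\<close>
  have "\<bar>s (k + n) - s k\<bar> \<le> C / (1 - q) * q ^ k * (1 - q ^ n)" for n
  proof (induction n)
    case (Suc n)
    have "\<bar>s (k + Suc n) - s k\<bar> \<le> C * q ^ (k + n) + C / (1 - q) * q ^ k * (1 - q ^ n)"
      using Suc step[of "k + n"] by simp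
    also have "\<dots> = C / (1 - q) * q ^ k * (1 - q ^ Suc n)"
      using q by (simp add: field_simps power_add)
    finally show ?case .
  qed simp
  moreover have "0 \<le> C / (1 - q) * q ^ k"
    using step[of 0] q by simp
  ultimately have "\<bar>s (k + n) - s k\<bar> \<le> C / (1 - q) * q ^ k" for n
    using q mult_left_le[of "1 - q ^ n" "C / (1 - q) * q ^ k" for n] order_trans by fastforce
  moreover have "(\<lambda>n. \<bar>s (n + k) - s k\<bar>) \<longlonglongrightarrow> \<bar>lim s - s k\<bar>"
    by (intro tendsto_intros LIMSEQ_ignore_initial_segment conv)
  ultimately show ?thesis
    by (intro LIMSEQ_le_const2) (auto simp: add.commute)
qed

section \<open>Oscillation decay for abstract averaging schemes\<close>

text \<open>The index \<open>i\<close> of a vertex corresponds to \<open>dbl i\<close> at the next finer level, hence distances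
  between consecutive levels are measured by \<^term>\<open>cheb l (dbl i)\<close>.\<close>

locale binary_averaging =
  fixes T :: "nat \<Rightarrow> int \<times> int \<Rightarrow> (int \<times> int) set"
    and a :: "nat \<Rightarrow> int \<times> int \<Rightarrow> int \<times> int \<Rightarrow> real"
    and z :: "nat \<Rightarrow> int \<times> int \<Rightarrow> real"
    and n :: nat and \<gamma> :: real
  assumes fin: "finite (T k l)"
    and nonneg: "i \<in> T k l \<Longrightarrow> 0 \<le> a k l i"
    and sum_1: "sum (a k l) (T k l) = 1"
    and near: "i \<in> T k l \<Longrightarrow> cheb l (dbl i) \<le> 2 ^ n"
    and mem: "cheb l (dbl i) \<le> 1 \<Longrightarrow> i \<in> T k l"
    and lower: "cheb l (dbl i) \<le> 1 \<Longrightarrow> \<gamma> \<le> a k l i"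
    and \<gamma>_pos: "0 < \<gamma>"
    and step: "z (Suc k) l = (\<Sum>i\<in>T k l. a k l i * z k i)"
begin

definition dependency_closed :: "(nat \<Rightarrow> (int \<times> int) set) \<Rightarrow> bool" where
  "dependency_closed S \<longleftrightarrow> (\<forall>k. \<forall>l\<in>S (Suc k). T k l \<subseteq> S k)"

text \<open>The radius \<open>2 ^ Suc n\<close> is twice the stencil reach, hence preserved on
  passing to stencil points; as a power of two it can be halved down to 1.\<close>

definition osc_le :: "(nat \<Rightarrow> (int \<times> int) set) \<Rightarrow> nat \<Rightarrow> real \<Rightarrow> bool" where
  "osc_le S k D \<longleftrightarrow> (\<forall>l\<in>S k. \<forall>m\<in>S k. cheb l m \<le> 2 ^ Suc n \<longrightarrow> \<bar>z k l - z k m\<bar> \<le> D)"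

text \<open>A lower bound for the probability that the independent coupling picks a prescribed pair
  of near indices.\<close>

definition \<delta> :: real where "\<delta> = \<gamma> * \<gamma>"

lemma a_le_1: "i \<in> T k l \<Longrightarrow> a k l i \<le> 1"
  using member_le_sum[of i "T k l" "a k l"] fin nonneg sum_1 by auto

lemma \<delta>: "0 < \<delta>" "\<delta> \<le> 1"
proof -
  have "cheb (0, 0) (dbl (0, 0)) \<le> 1" by (simp add: cheb_def dbl_def)
  then have "\<gamma> \<le> 1" using lower mem a_le_1 order_trans by blast
  then show "0 < \<delta>" "\<delta> \<le> 1" using \<gamma>_pos by (auto simp: \<delta>_def mult_le_one)
qed

text \<open>With \<open>N = 2 ^ n\<close>, twice the new distance is at most
  \<open>N + 2 * N + N\<close> by the triangle inequality.\<close>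

lemma stencil_points_close:
  assumes "i \<in> T k l" "i' \<in> T k m" "cheb l m \<le> 2 ^ Suc n"
  shows "cheb i i' \<le> 2 ^ Suc n"
proof -
  have *: "\<bar>x - x'\<bar> \<le> 2 * N"
    if "\<bar>u - 2 * x\<bar> \<le> N" "\<bar>v - 2 * x'\<bar> \<le> N" "\<bar>u - v\<bar> \<le> 2 * N" for x x' u v N :: int
    using that by linarith
  show ?thesis
    using near[OF assms(1)] near[OF assms(2)] assms(3) by (auto simp: cheb_le_iff dbl_def intro: *)
qed

text \<open>Product coupling with favoured pair \<open>(i, i')\<close>. It serves with
  \<open>D0 = D\<close> (no growth), with \<open>i = i'\<close> and \<open>D0 = 0\<close> (common
  near index), and with an inductive \<open>D0\<close> (halving).\<close>

lemma osc_step: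
  assumes S: "dependency_closed S" and osc: "osc_le S k D"
    and lm: "l \<in> S (Suc k)" "m \<in> S (Suc k)" "cheb l m \<le> 2 ^ Suc n"
    and i: "cheb l (dbl i) \<le> 1" and i': "cheb m (dbl i') \<le> 1"
    and D0: "\<bar>z k i - z k i'\<bar> \<le> D0" "D0 \<le> D"
  shows "\<bar>z (Suc k) l - z (Suc k) m\<bar> \<le> \<delta> * D0 + (1 - \<delta>) * D"
  unfolding step
proof (rule product_coupling)
  show "\<bar>z k i - z k j\<bar> \<le> D" if "i \<in> T k l" "j \<in> T k m" for i j
    using that S osc lm stencil_points_close[OF that lm(3)]
    unfolding dependency_closed_def osc_le_def by blast
  show "\<delta> \<le> a k l i * a k m i'"
    unfolding \<delta>_def using lower[OF i, of k] lower[OF i', of k] \<gamma>_pos by (intro mult_mono) linarith+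
qed (use fin nonneg sum_1 mem i i' D0 in auto)

lemma osc_mono:
  assumes S: "dependency_closed S" and osc: "osc_le S k D"
  shows "osc_le S (k + j) D"
proof (induction j)
  case (Suc j)
  show ?case
    unfolding osc_le_def
  proof (intro ballI impI)
    fix l m assume lm: "l \<in> S (k + Suc j)" "m \<in> S (k + Suc j)" "cheb l m \<le> 2 ^ Suc n"
    then obtain i i' where i: "cheb l (dbl i) \<le> 1" "cheb m (dbl i') \<le> 1"
      using cheb_halving[of l m "2 ^ n"] by auto
    have "T (k + j) l \<subseteq> S (k + j)" "T (k + j) m \<subseteq> S (k + j)"
      using S lm unfolding dependency_closed_def by simp_all
    then have "\<bar>z (k + j) i - z (k + j) i'\<bar> \<le> D"
      using Suc.IH mem[OF i(1)] mem[OF i(2)] stencil_points_close[OF mem[OF i(1)] mem[OF i(2)] lm(3)]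
      unfolding osc_le_def by blast
    from osc_step[OF S Suc.IH _ _ lm(3) i this order_refl] lm
    show "\<bar>z (k + Suc j) l - z (k + Suc j) m\<bar> \<le> D"
      by (simp add: algebra_simps)
  qed
qed (use osc in simp)

text \<open>From distance \<open>2 ^ j\<close>, \<open>j\<close> halvings followed by one common
  near index make the coupled pair coincide after \<open>Suc j\<close> levels; each of these choices
  has probability at least \<open>\<delta>\<close>.\<close>

lemma osc_contraction_dyadic:
  assumes S: "dependency_closed S" and osc: "osc_le S k D" and D: "0 \<le> D"
    and "j \<le> Suc n" "l \<in> S (k + Suc j)" "m \<in> S (k + Suc j)" "cheb l m \<le> 2 ^ j"
  shows "\<bar>z (k + Suc j) l - z (k + Suc j) m\<bar> \<le> (1 - \<delta> ^ Suc j) * D"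
  using assms(4-)
proof (induction j arbitrary: l m)
  case 0
  then obtain i where i: "cheb l (dbl i) \<le> 1" "cheb m (dbl i) \<le> 1"
    using cheb_le_1_common_parent[of l m] by auto
  have "cheb l m \<le> 2 ^ Suc n"
    using 0(4) one_le_power[of "2::int" "Suc n"] by simp
  from osc_step[OF S osc _ _ this i, of 0] 0 D show ?case by simp
next
  case (Suc j)
  from Suc.prems(4) obtain i i' where
    i: "cheb l (dbl i) \<le> 1" "cheb m (dbl i') \<le> 1" and ii': "cheb i i' \<le> 2 ^ j"
    using cheb_halving[of l m "2 ^ j"] by auto
  have mem': "i \<in> S (k + Suc j)" "i' \<in> S (k + Suc j)"
    using S Suc.prems mem[OF i(1)] mem[OF i(2)] unfolding dependency_closed_def by fastforce+
  have IH: "\<bar>z (k + Suc j) i - z (k + Suc j) i'\<bar> \<le> (1 - \<delta> ^ Suc j) * D"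
    using Suc.IH[OF _ mem' ii'] Suc.prems(1) by simp
  have "(2::int) ^ Suc j \<le> 2 ^ Suc n"
    using Suc.prems(1) by (intro power_increasing) auto
  then have lm: "cheb l m \<le> 2 ^ Suc n" using Suc.prems(4) by linarith
  have D0: "(1 - \<delta> ^ Suc j) * D \<le> D"
    using \<delta> D power_le_one[of \<delta> "Suc j"] by (intro mult_left_le_one_le) auto
  \<comment> \<open>At the intermediate level the remaining pairs are still controlled by
    \<open>D\<close>, through \<open>osc_mono\<close>.\<close>
  from osc_step[OF S osc_mono[OF S osc, of "Suc j"] _ _ lm i IH D0] Suc.prems
  have "\<bar>z (k + Suc (Suc j)) l - z (k + Suc (Suc j)) m\<bar>
      \<le> \<delta> * ((1 - \<delta> ^ Suc j) * D) + (1 - \<delta>) * D"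
    by simp
  also have "\<dots> = (1 - \<delta> ^ Suc (Suc j)) * D" by (simp add: algebra_simps)
  finally show ?case .
qed

lemma osc_geometric:
  assumes S: "dependency_closed S" and osc: "osc_le S 0 D" and D: "0 \<le> D"
  shows "\<exists>C q. 0 \<le> C \<and> 0 \<le> q \<and> q < 1 \<and> (\<forall>k. osc_le S k (C * q ^ k))"
proof -
  \<comment> \<open>The dyadic contraction with \<open>j = Suc n\<close> covers the whole radius and
    takes \<open>Suc (Suc n)\<close> levels.\<close>
  define p where "p = Suc (Suc n)"
  \<comment> \<open>The maximum keeps \<open>r\<close> positive even if \<open>\<delta> = 1\<close>;
    later there is a division by \<open>q ^ p = r\<close>.\<close>
  define r where "r = max (1/2) (1 - \<delta> ^ p)"
  have r: "0 < r" "r < 1" "1 - \<delta> ^ p \<le> r" using \<delta> by (auto simp: r_def)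
  have contr: "osc_le S (p * t) (r ^ t * D)" for t
  proof (induction t)
    case (Suc t)
    show ?case
      unfolding osc_le_def
    proof (intro ballI impI)
      fix l m assume lm: "l \<in> S (p * Suc t)" "m \<in> S (p * Suc t)" "cheb l m \<le> 2 ^ Suc n"
      have "p * Suc t = p * t + Suc (Suc n)" by (simp add: p_def)
      then have "\<bar>z (p * Suc t) l - z (p * Suc t) m\<bar> \<le> (1 - \<delta> ^ p) * (r ^ t * D)"
        using osc_contraction_dyadic[OF S Suc.IH _ order_refl, of l m] lm r D
        unfolding p_def by (simp del: mult_Suc mult_Suc_right power_Suc add_Suc_right)
      also have "\<dots> \<le> r * (r ^ t * D)" using r D by (intro mult_right_mono) auto
      finally show "\<bar>z (p * Suc t) l - z (p * Suc t) m\<bar> \<le> r ^ Suc t * D" by simp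
    qed
  qed (use osc in simp)
  \<comment> \<open>The root spreads the factor \<open>r\<close> of a block of \<open>p\<close>
    levels over single levels.\<close>
  define q where "q = root p r"
  have q: "0 < q" "q < 1" "q ^ p = r"
    using r real_root_pow_pos[of p r] by (auto simp: q_def p_def real_root_gt_zero simp del: power_Suc)
  have "osc_le S k (D / q ^ p * q ^ k)" for k
  proof -
    have "osc_le S (p * (k div p) + k mod p) (r ^ (k div p) * D)"
      by (rule osc_mono[OF S contr])
    then have osc': "osc_le S k (r ^ (k div p) * D)" by simp
    \<comment> \<open>An incomplete block loses at most \<open>p\<close> factors \<open>q\<close>,
      absorbed by the constant \<open>D / q ^ p\<close>.\<close>
    have "k \<le> p * (k div p) + p"
      using mod_less_divisor[of p k] mult_div_mod_eq[of p k] unfolding p_def by linarith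
    then have "q ^ (p * (k div p) + p) \<le> q ^ k" using q by (intro power_decreasing) auto
    then have "r ^ (k div p) \<le> q ^ k / q ^ p"
      using q(1) by (simp add: pos_le_divide_eq power_add power_mult flip: q(3))
    from mult_right_mono[OF this D] have "r ^ (k div p) * D \<le> D / q ^ p * q ^ k"
      by (simp add: mult.commute)
    then show ?thesis using osc' unfolding osc_le_def by (meson order_trans)
  qed
  then show ?thesis
    using q D by (intro exI[of _ "D / q ^ p"] exI[of _ q]) auto
qed

end

section \<open>The limit function in grid coordinates\<close>

text \<open>The index of the lower left corner of the level-\<open>k\<close> cell containing the point with
  coordinates \<open>p\<close> with respect to the basis.\<close>

definition cell :: "nat \<Rightarrow> real \<times> real \<Rightarrow> int \<times> int" where
  "cell k p = (\<lfloor>2 ^ k * fst p\<rfloor>, \<lfloor>2 ^ k * snd p\<rfloor>)"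

text \<open>Puts \<open>cell k p\<close> into the stencil of \<open>cell (Suc k) p\<close>, so
  following a point through the levels compares values within one stencil.\<close>

lemma cell_Suc: "cheb (cell (Suc k) p) (dbl (cell k p)) \<le> 1"
proof -
  have "\<bar>\<lfloor>2 * x\<rfloor> - 2 * \<lfloor>x\<rfloor>\<bar> \<le> 1" for x :: real by linarith
  from this[of "2 ^ k * fst p"] this[of "2 ^ k * snd p"]
  show ?thesis by (simp add: cheb_le_iff cell_def dbl_def mult.assoc)
qed

lemma cell_close:
  assumes "dist p p' < (1/2) ^ k"
  shows "cheb (cell k p) (cell k p') \<le> 1"
proof -
  have *: "\<bar>\<lfloor>2 ^ k * x\<rfloor> - \<lfloor>2 ^ k * y\<rfloor>\<bar> \<le> 1" if "dist x y < (1/2) ^ k" for x y :: real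
  proof -
    have "\<bar>2 ^ k * x - 2 ^ k * y\<bar> = 2 ^ k * \<bar>x - y\<bar>"
      by (simp add: abs_mult right_diff_distrib[symmetric])
    also have "\<dots> < 2 ^ k * (1/2) ^ k"
      using that by (intro mult_strict_left_mono) (auto simp: dist_real_def)
    finally have "\<bar>2 ^ k * x - 2 ^ k * y\<bar> < 1" by (simp add: power_one_over)
    then show ?thesis by linarith
  qed
  show ?thesis
    using assms dist_fst_le[of p p'] dist_snd_le[of p p']
    by (auto simp: cheb_le_iff cell_def intro!: *)
qed

context binary_averaging
begin

text \<open>The pointwise limit of the piecewise constant interpolants; \<open>lim\<close> is
  meaningful once the increments are known to be geometric.\<close>

definition limit_fun :: "real \<times> real \<Rightarrow> real" where
  "limit_fun p = lim (\<lambda>k. z k (cell k p))"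

text \<open>Between levels the interpolants change by at most the oscillation, so the limit is
  reached at a geometric rate; comparing adjacent cells then gives a modulus of continuity. The
  constants do not depend on the point.\<close>

lemma limit_fun_estimate:
  assumes S: "dependency_closed S" and osc: "osc_le S 0 D" and D: "0 \<le> D"
  shows "\<exists>C q. 0 \<le> q \<and> q < 1 \<and>
    (\<forall>k p. (\<forall>j. cell j p \<in> S j) \<longrightarrow> \<bar>limit_fun p - z k (cell k p)\<bar> \<le> C * q ^ k) \<and>
    (\<forall>k p p'. (\<forall>j. cell j p \<in> S j) \<longrightarrow> (\<forall>j. cell j p' \<in> S j) \<longrightarrow> dist p p' < (1/2) ^ k \<longrightarrow>
      \<bar>limit_fun p - limit_fun p'\<bar> \<le> C * q ^ k)"
proof -
  obtain C q where C: "0 \<le> C" and q: "0 \<le> q" "q < 1" and osc: "\<And>k. osc_le S k (C * q ^ k)"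
    using osc_geometric[OF assms] by blast
  define C' where "C' = C / (1 - q)"
  have C': "0 \<le> C'" using C q by (simp add: C'_def)
  have incr: "\<bar>z (Suc k) (cell (Suc k) p) - z k (cell k p)\<bar> \<le> C * q ^ k"
    if p: "\<And>j. cell j p \<in> S j" for k p
  proof -
    let ?l = "cell (Suc k) p"
    have c: "cell k p \<in> T k ?l" by (rule mem[OF cell_Suc])
    \<comment> \<open>The single value is an average over a singleton; coupling with weight 0 for
      the good pair says that an average of numbers within \<open>C * q ^ k\<close> of it is equally
      close.\<close>
    have "\<bar>z (Suc k) ?l - (\<Sum>i\<in>{cell k p}. 1 * z k i)\<bar> \<le> 0 * (C * q ^ k) + (1 - 0) * (C * q ^ k)"
      unfolding step
    proof (rule product_coupling)
      show le: "\<bar>z k i - z k j\<bar> \<le> C * q ^ k" if "i \<in> T k ?l" "j \<in> {cell k p}" for i j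
      proof -
        have "j \<in> T k ?l" using that c by simp
        then have "cheb i j \<le> 2 ^ Suc n"
          using that stencil_points_close[of i k ?l j ?l] by (simp add: cheb_def)
        moreover have "i \<in> S k" "j \<in> S k"
          using that p S unfolding dependency_closed_def by blast+
        ultimately show ?thesis using osc unfolding osc_le_def by blast
      qed
      show "\<bar>z k (cell k p) - z k (cell k p)\<bar> \<le> C * q ^ k" using C q by simp
    qed (use c fin nonneg sum_1 in auto)
    then show ?thesis by simp
  qed
  have est: "\<bar>limit_fun p - z k (cell k p)\<bar> \<le> C' * q ^ k" if "\<And>j. cell j p \<in> S j" for k p
    unfolding limit_fun_def C'_def
    by (rule geometric_increments_limit[OF q]) (rule incr[OF that])
  \<comment> \<open>Two interpolation errors \<open>C'\<close> plus one oscillation \<open>C\<close>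
    between adjacent cells.\<close>
  have cont: "\<bar>limit_fun p - limit_fun p'\<bar> \<le> (2 * C' + C) * q ^ k"
    if p: "\<And>j. cell j p \<in> S j" "\<And>j. cell j p' \<in> S j" and d: "dist p p' < (1/2) ^ k" for k p p'
  proof -
    have "cheb (cell k p) (cell k p') \<le> 2 ^ Suc n"
      using cell_close[OF d] one_le_power[of "2::int" "Suc n"] by linarith
    then have "\<bar>z k (cell k p) - z k (cell k p')\<bar> \<le> C * q ^ k"
      using osc p unfolding osc_le_def by blast
    with est[OF p(1), of k] est[OF p(2), of k] show ?thesis
      unfolding distrib_right by linarith
  qed
  have "C' * q ^ k \<le> (2 * C' + C) * q ^ k" for k
    using C C' q by (intro mult_right_mono) auto
  with est have "\<bar>limit_fun p - z k (cell k p)\<bar> \<le> (2 * C' + C) * q ^ k"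
    if "\<And>j. cell j p \<in> S j" for k p
    using that order_trans by blast
  with cont q show ?thesis by (intro exI[of _ "2 * C' + C"] exI[of _ q]) simp
qed

end

section \<open>The plane in the basis \<open>e1\<close>, \<open>e2\<close>\<close>

definition frame :: "real^2 \<Rightarrow> real^2 \<Rightarrow> real \<times> real \<Rightarrow> real^2" where
  "frame e1 e2 p = fst p *\<^sub>R e1 + snd p *\<^sub>R e2"

lemma linear_frame: "linear (frame e1 e2)"
  by (rule linearI) (auto simp: frame_def algebra_simps)

lemma norm_frame_le:
  "\<bar>fst p\<bar> \<le> r \<Longrightarrow> \<bar>snd p\<bar> \<le> r \<Longrightarrow> norm (frame e1 e2 p) \<le> r * (norm e1 + norm e2)"
  unfolding frame_def distrib_left
  by (rule order_trans[OF norm_triangle_ineq]) (auto intro!: add_mono mult_right_mono)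

lemma grid_vertex_eq_frame:
  "grid_vertex e1 e2 k l = frame e1 e2 ((1/2)^k * real_of_int (fst l), (1/2)^k * real_of_int (snd l))"
  by (simp add: grid_vertex_def frame_def)

text \<open>Vertex \<open>i\<close> of level \<open>k\<close> is vertex \<open>dbl i\<close> of
  level \<open>Suc k\<close>. Hence, after rescaling, stencils and weights depend on
  \<open>l - dbl i\<close> only.\<close>

lemma grid_vertex_diff:
  "grid_vertex e1 e2 (Suc k) l - grid_vertex e1 e2 k i =
    (1/2)^Suc k *\<^sub>R frame e1 e2 (real_of_int (fst l - 2 * fst i), real_of_int (snd l - 2 * snd i))"
  by (simp add: grid_vertex_def frame_def algebra_simps)

lemma cell_grid_coordinates:
  "cell k ((1/2)^k * real_of_int (fst l), (1/2)^k * real_of_int (snd l)) = l"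
  by (simp add: cell_def power_one_over)

lemma norm_grid_vertex_cell:
  "norm (grid_vertex e1 e2 k (cell k p)) \<le> norm (frame e1 e2 p) + (1/2)^k * (norm e1 + norm e2)"
proof -
  have *: "\<bar>x - (1/2)^k * real_of_int \<lfloor>2^k * x\<rfloor>\<bar> \<le> (1/2)^k" for x :: real
  proof -
    have "\<bar>2^k * x - real_of_int \<lfloor>2^k * x\<rfloor>\<bar> \<le> 1" by linarith
    then have "(1/2)^k * \<bar>2^k * x - real_of_int \<lfloor>2^k * x\<rfloor>\<bar> \<le> (1/2)^k * 1"
      by (intro mult_left_mono) auto
    moreover have "(1/2)^k * \<bar>2^k * x - real_of_int \<lfloor>2^k * x\<rfloor>\<bar>
        = \<bar>(1/2)^k * (2^k * x - real_of_int \<lfloor>2^k * x\<rfloor>)\<bar>"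
      by (simp add: abs_mult)
    moreover have "(1/2)^k * (2^k * x - real_of_int \<lfloor>2^k * x\<rfloor>)
        = x - (1/2)^k * real_of_int \<lfloor>2^k * x\<rfloor>"
      by (simp add: algebra_simps power_one_over)
    ultimately show ?thesis by simp
  qed
  have "frame e1 e2 p - grid_vertex e1 e2 k (cell k p) = frame e1 e2
      (fst p - (1/2)^k * real_of_int \<lfloor>2^k * fst p\<rfloor>, snd p - (1/2)^k * real_of_int \<lfloor>2^k * snd p\<rfloor>)"
    by (simp add: grid_vertex_def cell_def frame_def algebra_simps)
  then have "norm (frame e1 e2 p - grid_vertex e1 e2 k (cell k p)) \<le> (1/2)^k * (norm e1 + norm e2)"
    using norm_frame_le[OF _ _, of _ "(1/2)^k"] * by simp
  then show ?thesis
    using norm_triangle_sub[of "grid_vertex e1 e2 k (cell k p)" "frame e1 e2 p"]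
    by (simp add: norm_minus_commute)
qed

section \<open>Uniform deviation and growth of the data\<close>

lemma sup_deviation_tendsto_0:
  assumes q: "0 \<le> q" "q < 1"
    and le: "\<And>k l. l \<in> A k \<Longrightarrow> \<bar>z k l - F (grid_vertex e1 e2 k l)\<bar> \<le> C * q ^ k"
  shows "(\<lambda>k. sup_deviation e1 e2 (z k) F k (A k)) \<longlonglongrightarrow> 0"
proof (rule tendsto_sandwich[OF _ _ tendsto_const])
  have "(\<lambda>k. C * q ^ k) \<longlonglongrightarrow> C * 0"
    using q by (intro tendsto_intros LIMSEQ_power_zero) auto
  then show "(\<lambda>k. ennreal (C * q ^ k)) \<longlonglongrightarrow> 0"
    using tendsto_ennrealI by fastforce
  show "\<forall>\<^sub>F k in sequentially. sup_deviation e1 e2 (z k) F k (A k) \<le> ennreal (C * q ^ k)"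
    unfolding sup_deviation_def
    by (intro always_eventually allI SUP_least ennreal_leI le)
qed simp

text \<open>A path of horizontal and then vertical edges joins two indices in at most
  \<open>2 * cheb l m\<close> steps.\<close>

lemma bounded_edge_differences_cheb:
  assumes "bounded_edge_differences z"
  shows "\<exists>M\<ge>0. \<forall>l m. \<bar>z l - z m\<bar> \<le> M * of_int (cheb l m)"
proof -
  obtain M where M: "\<And>l d. d \<in> {(1,0), (0,1), (1,1)} \<Longrightarrow> \<bar>z (l + d) - z l\<bar> \<le> M"
    using assms unfolding bounded_edge_differences_def by blast
  have M0: "0 \<le> M" using M[of "(1,0)" 0] by (auto intro: order_trans[OF abs_ge_zero])
  have right: "\<bar>z (x + int j, y) - z (x, y)\<bar> \<le> M * j" for x y j
  proof (induction j)
    case (Suc j)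
    show ?case using M[of "(1,0)" "(x + int j, y)"] Suc by (simp add: algebra_simps)
  qed simp
  have up: "\<bar>z (x, y + int j) - z (x, y)\<bar> \<le> M * j" for x y j
  proof (induction j)
    case (Suc j)
    show ?case using M[of "(0,1)" "(x, y + int j)"] Suc by (simp add: algebra_simps)
  qed simp
  have h: "\<bar>z (x, y) - z (x', y)\<bar> \<le> M * \<bar>x - x'\<bar>" for x x' y
    using right[of x "nat (x' - x)" y] right[of x' "nat (x - x')" y]
    by (cases "x \<le> x'") (simp_all add: abs_minus_commute)
  have v: "\<bar>z (x, y) - z (x, y')\<bar> \<le> M * \<bar>y - y'\<bar>" for x y y'
    using up[of x y "nat (y' - y)"] up[of x y' "nat (y - y')"]
    by (cases "y \<le> y'") (simp_all add: abs_minus_commute)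
  have "\<bar>z l - z m\<bar> \<le> 2 * M * of_int (cheb l m)" for l m
  proof -
    have "\<bar>z l - z m\<bar> \<le> M * \<bar>fst l - fst m\<bar> + M * \<bar>snd l - snd m\<bar>"
      using h[of "fst l" "snd l" "fst m"] v[of "fst m" "snd l" "snd m"] by simp
    moreover have "M * \<bar>fst l - fst m\<bar> \<le> M * cheb l m" "M * \<bar>snd l - snd m\<bar> \<le> M * cheb l m"
      using M0 by (intro mult_left_mono; simp add: cheb_def)+
    ultimately show ?thesis by simp
  qed
  then show ?thesis using M0 by (intro exI[of _ "2 * M"]) simp
qed

section \<open>Stencils and coefficients of the ball schemes\<close>

locale ball_weight_scheme =
  fixes e1 e2 :: "real^2" and L :: real and W :: "real \<Rightarrow> real"
  assumes indep: "independent {e1, e2}" and distinct: "e1 \<noteq> e2"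
    and L: "norm e1 < L" "norm e2 < L"
    and W: "0 \<le> t \<Longrightarrow> t < 1 \<Longrightarrow> 0 < W t \<and> W t \<le> 1"
begin

lemma L_pos: "0 < L"
  using L(1) norm_ge_zero[of e1] by linarith

lemma inj_frame: "inj (frame e1 e2)"
proof (subst linear_injective_0[OF linear_frame], intro allI impI)
  fix p assume p: "frame e1 e2 p = 0"
  let ?u = "\<lambda>v. if v = e1 then fst p else snd p"
  have "(\<Sum>v\<in>{e1, e2}. ?u v *\<^sub>R v) = 0"
    using p distinct by (auto simp: frame_def)
  then have "\<forall>v\<in>{e1, e2}. ?u v = 0"
    using independentD[OF indep, of "{e1, e2}" ?u] by blast
  then show "p = 0"
    using distinct by (auto simp: prod_eq_iff split: if_splits)
qed

lemma frame_inv: "frame e1 e2 (inv (frame e1 e2) x) = x"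
proof -
  have "surj (frame e1 e2)"
    by (rule linear_injective_imp_surjective[OF linear_frame inj_frame]) simp
  then show ?thesis by (rule surj_f_inv_f)
qed

lemma frame_bounded_below: "\<exists>B>0. \<forall>p. B * norm p \<le> norm (frame e1 e2 p)"
  using linear_inj_bounded_below_pos[OF linear_frame inj_frame] by metis

lemma stencil_iff:
  "i \<in> stencil e1 e2 L k l \<longleftrightarrow>
    norm (frame e1 e2 (real_of_int (fst l - 2 * fst i), real_of_int (snd l - 2 * snd i))) < 2 * L"
  unfolding stencil_def mem_Collect_eq grid_vertex_diff by (simp add: power_one_over field_simps)

lemma stencil_weight_eq:
  "stencil_weight e1 e2 L W k l i =
    W (norm (frame e1 e2 (real_of_int (fst l - 2 * fst i), real_of_int (snd l - 2 * snd i))) / (2 * L))"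
  unfolding stencil_weight_def grid_vertex_diff by (simp add: power_one_over field_simps)

lemma stencil_weight_bounds:
  assumes "i \<in> stencil e1 e2 L k l"
  shows "0 < stencil_weight e1 e2 L W k l i" "stencil_weight e1 e2 L W k l i \<le> 1"
  using assms L_pos unfolding stencil_iff stencil_weight_eq
  by (auto intro!: W[THEN conjunct1] W[THEN conjunct2])

text \<open>Offsets with entries in -1, 0, 1 give vectors of norm at most
  \<open>norm e1 + norm e2\<close>, which is below \<open>2 * L\<close>.\<close>

lemma stencil_mem:
  assumes "cheb l (dbl i) \<le> 1"
  shows "i \<in> stencil e1 e2 L k l"
proof -
  have "\<bar>fst l - 2 * fst i\<bar> \<le> 1" "\<bar>snd l - 2 * snd i\<bar> \<le> 1"
    using assms by (auto simp: cheb_le_iff dbl_def)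
  then have "norm (frame e1 e2 (real_of_int (fst l - 2 * fst i), real_of_int (snd l - 2 * snd i)))
      \<le> 1 * (norm e1 + norm e2)"
    by (intro norm_frame_le) (simp_all only: fst_conv snd_conv of_int_abs[symmetric] of_int_le_1_iff)
  also have "\<dots> < 2 * L" using L by simp
  finally show ?thesis unfolding stencil_iff .
qed

text \<open>The injective frame is bounded below by some \<open>B\<close>, so offsets are below
  \<open>2 * L / B\<close>, rounded up to a power of two for repeated halving.\<close>

lemma stencil_near: "\<exists>n. \<forall>k l. \<forall>i\<in>stencil e1 e2 L k l. cheb l (dbl i) \<le> 2 ^ n"
proof -
  obtain B where B: "0 < B" "\<And>p. B * norm p \<le> norm (frame e1 e2 p)"
    using frame_bounded_below by blast
  obtain n where n: "2 * L / B < 2 ^ n"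
    using real_arch_pow[of 2 "2 * L / B"] by auto
  have "cheb l (dbl i) \<le> 2 ^ n" if i: "i \<in> stencil e1 e2 L k l" for k l i
  proof -
    let ?p = "(real_of_int (fst l - 2 * fst i), real_of_int (snd l - 2 * snd i))"
    have "B * norm ?p < 2 * L" using B(2)[of ?p] i unfolding stencil_iff by linarith
    also have "\<dots> < B * 2 ^ n" using n B(1) by (simp add: field_simps)
    finally have "norm ?p < 2 ^ n" using B(1) by (simp only: mult_less_cancel_left_pos)
    then have "\<bar>real_of_int (fst l - 2 * fst i)\<bar> < 2 ^ n" "\<bar>real_of_int (snd l - 2 * snd i)\<bar> < 2 ^ n"
      using norm_fst_le[of "fst ?p" "snd ?p"] norm_snd_le[of "snd ?p" "fst ?p"] by auto
    then have "real_of_int \<bar>fst l - 2 * fst i\<bar> < real_of_int (2 ^ n)"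
      "real_of_int \<bar>snd l - 2 * snd i\<bar> < real_of_int (2 ^ n)"
      by simp_all
    then show ?thesis
      unfolding of_int_less_iff by (simp add: cheb_le_iff dbl_def)
  qed
  then show ?thesis by blast
qed

text \<open>A crude count, uniform in \<open>k\<close> and \<open>l\<close>, that will bound the
  denominators of the coefficients.\<close>

lemma card_stencil_le:
  assumes n: "\<And>i. i \<in> stencil e1 e2 L k l \<Longrightarrow> cheb l (dbl i) \<le> 2 ^ n"
  shows "card (stencil e1 e2 L k l) \<le> (2 * 2 ^ n + 1)\<^sup>2"
proof -
  let ?I = "\<lambda>c::int. {c div 2 - 2 ^ n..c div 2 + 2 ^ n}"
  have *: "x \<in> {c div 2 - N..c div 2 + N}" if "\<bar>c - 2 * x\<bar> \<le> N" "1 \<le> N" for c x N :: int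
  proof -
    have "2 * (c div 2) \<le> c" "c \<le> 2 * (c div 2) + 1" by presburger+
    then show ?thesis using that unfolding atLeastAtMost_iff by linarith
  qed
  have "stencil e1 e2 L k l \<subseteq> ?I (fst l) \<times> ?I (snd l)"
    using n * by (fastforce simp: cheb_le_iff dbl_def mem_Times_iff)
  then have "card (stencil e1 e2 L k l) \<le> card (?I (fst l) \<times> ?I (snd l))"
    by (intro card_mono) auto
  also have "\<dots> = (nat (2 * 2 ^ n + 1))\<^sup>2"
    by (simp add: card_cartesian_product power2_eq_square algebra_simps)
  also have "nat (2 * 2 ^ n + 1) = 2 * 2 ^ n + 1"
    by (simp add: nat_add_distrib nat_mult_distrib nat_power_eq)
  finally show ?thesis .
qed

text \<open>\<open>W\<close> may come arbitrarily close to 0, but the lower bound concerns only nine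
  offsets, so their least weight \<open>c\<close> is positive. Weights are at most 1, so their sum
  is at most the stencil size; this yields \<open>\<gamma>\<close>.\<close>

lemma binary_averaging:
  "\<exists>n \<gamma>. binary_averaging (stencil e1 e2 L) (subdiv_coeff e1 e2 L W) (subdiv_data e1 e2 L W z0) n \<gamma>"
proof -
  obtain n where n: "\<And>k l i. i \<in> stencil e1 e2 L k l \<Longrightarrow> cheb l (dbl i) \<le> 2 ^ n"
    using stencil_near by blast
  define w where "w = (\<lambda>d. W (norm (frame e1 e2 (real_of_int (fst d), real_of_int (snd d))) / (2 * L)))"
  define c where "c = Min (w ` ({-1..1} \<times> {-1..1}))"
  define \<gamma> where "\<gamma> = c / real ((2 * 2 ^ n + 1)\<^sup>2)"
  note fin = finite_stencil[OF indep distinct]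
  have nonempty: "stencil e1 e2 L k l \<noteq> {}" for k l
    using cheb_halving[of l l 0] stencil_mem by (force simp: cheb_def)
  have sum_pos: "0 < (\<Sum>j\<in>stencil e1 e2 L k l. stencil_weight e1 e2 L W k l j)" for k l
    by (intro sum_pos fin nonempty stencil_weight_bounds)
  have w_near: "stencil_weight e1 e2 L W k l i = w (fst l - 2 * fst i, snd l - 2 * snd i)" for k l i
    by (simp add: w_def stencil_weight_eq)
  have "0 < w d" if "d \<in> {-1..1} \<times> {-1..1}" for d
  proof -
    have "(0, 0) \<in> stencil e1 e2 L 0 d"
      using that by (intro stencil_mem) (auto simp: cheb_le_iff dbl_def)
    from stencil_weight_bounds(1)[OF this] show ?thesis by (simp add: w_near)
  qed
  then have c: "0 < c" unfolding c_def by (subst Min_gr_iff) auto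
  show ?thesis
  proof (intro exI, unfold_locales)
    show "0 < \<gamma>"
      unfolding \<gamma>_def by (intro divide_pos_pos c, unfold of_nat_0_less_iff, rule zero_less_power) simp
    show "sum (subdiv_coeff e1 e2 L W k l) (stencil e1 e2 L k l) = 1" for k l
      using sum_pos[of k l] by (simp add: subdiv_coeff_def sum_divide_distrib[symmetric])
    show "0 \<le> subdiv_coeff e1 e2 L W k l i" if "i \<in> stencil e1 e2 L k l" for k l i
      using sum_pos[of k l] stencil_weight_bounds[OF that] by (simp add: subdiv_coeff_def)
    show "\<gamma> \<le> subdiv_coeff e1 e2 L W k l i" if i: "cheb l (dbl i) \<le> 1" for k l i
    proof -
      have "c \<le> stencil_weight e1 e2 L W k l i"
        unfolding c_def w_near using i by (intro Min_le imageI) (auto simp: cheb_le_iff dbl_def)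
      moreover have "(\<Sum>j\<in>stencil e1 e2 L k l. stencil_weight e1 e2 L W k l j)
          \<le> (\<Sum>j\<in>stencil e1 e2 L k l. 1)"
        by (intro sum_mono stencil_weight_bounds)
      moreover have "real (card (stencil e1 e2 L k l)) \<le> real ((2 * 2 ^ n + 1)\<^sup>2)"
        by (intro of_nat_mono card_stencil_le n)
      ultimately show ?thesis
        unfolding \<gamma>_def subdiv_coeff_def using c sum_pos[of k l] by (intro frac_le) auto
    qed
    show "cheb l (dbl i) \<le> 2 ^ n" if "i \<in> stencil e1 e2 L k l" for k l i
      by (rule n[OF that])
  qed (auto simp: fin stencil_mem)
qed

section \<open>Localization to balls\<close>

text \<open>The margin \<open>2 * (1/2)^k * L\<close> is the sum of the radii \<open>(1/2)^j * L\<close> over all \<open>j \<ge> k\<close>, so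
  that the data on these sets depend only on the initial data on the (finite) first one.\<close>

definition enlarged_ball :: "real \<Rightarrow> nat \<Rightarrow> (int \<times> int) set" where
  "enlarged_ball R k = {l. norm (grid_vertex e1 e2 k l) < R + 2 * ((1/2)^k * L)}"

lemma finite_enlarged_ball_0: "finite (enlarged_ball R 0)"
proof -
  \<comment> \<open>A ball about the origin is a stencil of index \<open>(0, 0)\<close> for the
    radius \<open>R + 2 * L\<close>.\<close>
  have "enlarged_ball R 0 = stencil e1 e2 (R + 2 * L) 0 (0, 0)"
    by (simp add: enlarged_ball_def stencil_def grid_vertex_def[of _ _ "Suc 0" "(0, 0)"])
  then show ?thesis using finite_stencil[OF indep distinct] by simp
qed

lemma stencil_enlarged_ball:
  assumes "l \<in> enlarged_ball R (Suc k)"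
  shows "stencil e1 e2 L k l \<subseteq> enlarged_ball R k"
proof
  fix i assume "i \<in> stencil e1 e2 L k l"
  then have "norm (grid_vertex e1 e2 (Suc k) l - grid_vertex e1 e2 k i) < (1/2)^k * L"
    by (simp add: stencil_def)
  moreover have "norm (grid_vertex e1 e2 (Suc k) l) < R + (1/2)^k * L"
    using assms by (simp add: enlarged_ball_def)
  ultimately have "norm (grid_vertex e1 e2 k i) < R + 2 * ((1/2)^k * L)"
    using norm_triangle_sub[of "grid_vertex e1 e2 k i" "grid_vertex e1 e2 (Suc k) l"]
    by (simp add: norm_minus_commute)
  then show "i \<in> enlarged_ball R k" by (simp add: enlarged_ball_def)
qed

text \<open>The margin exceeds the error of rounding \<open>p\<close> to its cell corner, because
  \<open>norm e1 + norm e2 < 2 * L\<close>.\<close>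

lemma cell_enlarged_ball:
  assumes "norm (frame e1 e2 p) \<le> R"
  shows "cell k p \<in> enlarged_ball R k"
proof -
  have "(1/2)^k * (norm e1 + norm e2) < (1/2)^k * (2 * L)"
    using L by (intro mult_strict_left_mono) auto
  then show ?thesis
    using norm_grid_vertex_cell[of e1 e2 k p] assms
    unfolding enlarged_ball_def mem_Collect_eq by linarith
qed

section \<open>Continuity of the limit and convergence\<close>

text \<open>\<open>limit_fun\<close> involves no index family, so one \<open>F\<close> serves both
  the balls (continuity, compact sets) and the whole grid.\<close>

lemma convergence:
  "\<exists>F. continuous_on UNIV F \<and>
    (bounded_edge_differences z0 \<longrightarrow>
      (\<lambda>k. sup_deviation e1 e2 (subdiv_data e1 e2 L W z0 k) F k UNIV) \<longlonglongrightarrow> 0) \<and>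
    (\<forall>K. compact K \<longrightarrow>
      (\<lambda>k. sup_deviation e1 e2 (subdiv_data e1 e2 L W z0 k) F k {l. grid_vertex e1 e2 k l \<in> K})
        \<longlonglongrightarrow> 0)"
proof -
  obtain n \<gamma> where
    "binary_averaging (stencil e1 e2 L) (subdiv_coeff e1 e2 L W) (subdiv_data e1 e2 L W z0) n \<gamma>"
    using binary_averaging by blast
  then interpret binary_averaging "stencil e1 e2 L" "subdiv_coeff e1 e2 L W"
    "subdiv_data e1 e2 L W z0" n \<gamma> .
  define g where "g = inv (frame e1 e2)"
  define F where "F = (\<lambda>x. limit_fun (g x))"
  have frame_g: "frame e1 e2 (g x) = x" for x by (simp add: g_def frame_inv)
  have g_vertex: "g (grid_vertex e1 e2 k l) =
      ((1/2)^k * real_of_int (fst l), (1/2)^k * real_of_int (snd l))" for k l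
    unfolding g_def grid_vertex_eq_frame by (rule inv_f_f[OF inj_frame])
  \<comment> \<open>At a grid vertex the cell corner is the vertex itself, so the interpolation
    error is the deviation there.\<close>
  have cell_g: "cell k (g (grid_vertex e1 e2 k l)) = l" for k l
    unfolding g_vertex by (rule cell_grid_coordinates)
  have local: "\<exists>C q. 0 \<le> q \<and> q < 1 \<and>
      (\<forall>k p. norm (frame e1 e2 p) \<le> R \<longrightarrow>
        \<bar>limit_fun p - subdiv_data e1 e2 L W z0 k (cell k p)\<bar> \<le> C * q ^ k) \<and>
      (\<forall>k p p'. norm (frame e1 e2 p) \<le> R \<longrightarrow> norm (frame e1 e2 p') \<le> R \<longrightarrow> dist p p' < (1/2) ^ k \<longrightarrow>
        \<bar>limit_fun p - limit_fun p'\<bar> \<le> C * q ^ k)" for R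
  proof -
    have S: "dependency_closed (enlarged_ball R)"
      unfolding dependency_closed_def using stencil_enlarged_ball by blast
    \<comment> \<open>Finitely many initial values are bounded, however fast \<open>z0\<close>
      grows.\<close>
    obtain D where D: "0 < D" "\<And>l. l \<in> enlarged_ball R 0 \<Longrightarrow> \<bar>z0 l\<bar> \<le> D"
      using finite_imp_bounded[OF finite_imageI[OF finite_enlarged_ball_0, of z0 R]]
      unfolding bounded_pos by auto
    have "osc_le (enlarged_ball R) 0 (2 * D)"
      unfolding osc_le_def
    proof (intro ballI impI)
      fix l m assume "l \<in> enlarged_ball R 0" "m \<in> enlarged_ball R 0"
      from D(2)[OF this(1)] D(2)[OF this(2)]
      show "\<bar>subdiv_data e1 e2 L W z0 0 l - subdiv_data e1 e2 L W z0 0 m\<bar> \<le> 2 * D" by simp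
    qed
    from limit_fun_estimate[OF S this] D(1) obtain C q where "0 \<le> q" "q < 1" and
      "\<forall>k p. (\<forall>j. cell j p \<in> enlarged_ball R j) \<longrightarrow>
        \<bar>limit_fun p - subdiv_data e1 e2 L W z0 k (cell k p)\<bar> \<le> C * q ^ k" and
      "\<forall>k p p'. (\<forall>j. cell j p \<in> enlarged_ball R j) \<longrightarrow> (\<forall>j. cell j p' \<in> enlarged_ball R j) \<longrightarrow>
        dist p p' < (1/2) ^ k \<longrightarrow> \<bar>limit_fun p - limit_fun p'\<bar> \<le> C * q ^ k"
      by (metis mult_nonneg_nonneg less_imp_le zero_le_numeral)
    then show ?thesis using cell_enlarged_ball[of _ R] by (intro exI[of _ C] exI[of _ q]) simp
  qed
  have "isCont F x" for x
    unfolding continuous_at_eps_delta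
  proof (intro allI impI)
    fix \<epsilon> :: real assume \<epsilon>: "0 < \<epsilon>"
    obtain B where B: "0 < B" "\<And>p. B * norm p \<le> norm (frame e1 e2 p)"
      using frame_bounded_below by blast
    obtain C q where q: "0 \<le> q" "q < 1" and
      est: "\<And>k p p'. norm (frame e1 e2 p) \<le> norm x + 1 \<Longrightarrow> norm (frame e1 e2 p') \<le> norm x + 1 \<Longrightarrow>
        dist p p' < (1/2) ^ k \<Longrightarrow> \<bar>limit_fun p - limit_fun p'\<bar> \<le> C * q ^ k"
      using local[of "norm x + 1"] by blast
    have "(\<lambda>k. C * q ^ k) \<longlonglongrightarrow> C * 0"
      using q by (intro tendsto_intros LIMSEQ_power_zero) auto
    then have "\<forall>\<^sub>F k in sequentially. C * q ^ k < \<epsilon>" using \<epsilon> by (intro order_tendstoD) auto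
    then obtain k where k: "C * q ^ k < \<epsilon>" by (auto simp: eventually_sequentially)
    show "\<exists>d>0. \<forall>x'. dist x' x < d \<longrightarrow> dist (F x') (F x) < \<epsilon>"
    proof (intro exI conjI allI impI)
      \<comment> \<open>\<open>min 1\<close> keeps \<open>x'\<close> in the ball of radius
        \<open>norm x + 1\<close>; the factor \<open>B\<close> makes the coordinates differ by less
        than \<open>(1/2) ^ k\<close>.\<close>
      show "0 < min 1 (B * (1/2) ^ k)" using B by simp
      fix x' assume d: "dist x' x < min 1 (B * (1/2) ^ k)"
      have "B * dist (g x') (g x) \<le> dist x' x"
        using B(2)[of "g x' - g x"] by (simp add: dist_norm linear_diff[OF linear_frame] frame_g)
      then have "B * dist (g x') (g x) < B * (1/2) ^ k" using d by linarith
      then have "dist (g x') (g x) < (1/2) ^ k" using B(1) by (simp only: mult_less_cancel_left_pos)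
      moreover have "norm x' \<le> norm x + 1"
        using d norm_triangle_sub[of x' x] by (simp add: dist_norm)
      ultimately have "\<bar>F x' - F x\<bar> \<le> C * q ^ k"
        unfolding F_def by (intro est) (simp_all add: frame_g)
      then show "dist (F x') (F x) < \<epsilon>" using k by (simp add: dist_real_def)
    qed
  qed
  then have cont: "continuous_on UNIV F" by (simp add: continuous_on_eq_continuous_at)
  have global: "(\<lambda>k. sup_deviation e1 e2 (subdiv_data e1 e2 L W z0 k) F k UNIV) \<longlonglongrightarrow> 0"
    if bed: "bounded_edge_differences z0"
  proof -
    obtain M where M: "0 \<le> M" "\<And>l m. \<bar>z0 l - z0 m\<bar> \<le> M * of_int (cheb l m)"
      using bounded_edge_differences_cheb[OF bed] by blast
    \<comment> \<open>On the family of all indices, bounded edge differences take over the role of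
      the finite initial set.\<close>
    have "osc_le (\<lambda>_. UNIV) 0 (M * 2 ^ Suc n)"
      unfolding osc_le_def
    proof (intro ballI impI)
      fix l m :: "int \<times> int" assume "cheb l m \<le> 2 ^ Suc n"
      then have "real_of_int (cheb l m) \<le> real_of_int (2 ^ Suc n)" by (simp only: of_int_le_iff)
      from mult_left_mono[OF this M(1)] M(2)[of l m]
      show "\<bar>subdiv_data e1 e2 L W z0 0 l - subdiv_data e1 e2 L W z0 0 m\<bar> \<le> M * 2 ^ Suc n" by simp
    qed
    from limit_fun_estimate[OF _ this] M(1) obtain C q where q: "0 \<le> q" "q < 1" and
      est: "\<And>k p. \<bar>limit_fun p - subdiv_data e1 e2 L W z0 k (cell k p)\<bar> \<le> C * q ^ k"
      by (auto simp: dependency_closed_def)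
    show ?thesis
    proof (rule sup_deviation_tendsto_0[OF q])
      show "\<bar>subdiv_data e1 e2 L W z0 k l - F (grid_vertex e1 e2 k l)\<bar> \<le> C * q ^ k" for k l
        using est[of "g (grid_vertex e1 e2 k l)" k]
        unfolding F_def cell_g by (simp add: abs_minus_commute)
    qed
  qed
  have "(\<lambda>k. sup_deviation e1 e2 (subdiv_data e1 e2 L W z0 k) F k {l. grid_vertex e1 e2 k l \<in> K})
      \<longlonglongrightarrow> 0"
    if "compact K" for K
  proof -
    obtain R where R: "\<And>x. x \<in> K \<Longrightarrow> norm x \<le> R"
      using compact_imp_bounded[OF \<open>compact K\<close>] by (auto simp: bounded_iff)
    obtain C q where q: "0 \<le> q" "q < 1" and
      est: "\<And>k p. norm (frame e1 e2 p) \<le> R \<Longrightarrow>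
        \<bar>limit_fun p - subdiv_data e1 e2 L W z0 k (cell k p)\<bar> \<le> C * q ^ k"
      using local[of R] by blast
    show ?thesis
    proof (rule sup_deviation_tendsto_0[OF q])
      show "\<bar>subdiv_data e1 e2 L W z0 k l - F (grid_vertex e1 e2 k l)\<bar> \<le> C * q ^ k"
        if "l \<in> {l. grid_vertex e1 e2 k l \<in> K}" for k l
        using est[of "g (grid_vertex e1 e2 k l)" k] R that
        unfolding F_def cell_g frame_g by (simp add: abs_minus_commute)
    qed
  qed
  with cont global show ?thesis by blast
qed

end

theorem corollary4p1:
  fixes e1 e2 :: "real^2" and L :: real and W :: "real \<Rightarrow> real"
  assumes "independent {e1, e2}" and "e1 \<noteq> e2"
    and "L > Max {norm e1, norm e2, norm (e1 + e2)}"
    and "\<And>t. 0 \<le> t \<Longrightarrow> t < 1 \<Longrightarrow> 0 < W t \<and> W t \<le> 1"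
  shows "\<forall>z0 :: int \<times> int \<Rightarrow> real. \<exists>F :: real^2 \<Rightarrow> real.
    continuous_on UNIV F \<and>
    (bounded_edge_differences z0 \<longrightarrow>
      (\<lambda>k. sup_deviation e1 e2 (subdiv_data e1 e2 L W z0 k) F k UNIV) \<longlonglongrightarrow> 0) \<and>
    (\<forall>K. compact K \<longrightarrow>
      (\<lambda>k. sup_deviation e1 e2 (subdiv_data e1 e2 L W z0 k) F k {l. grid_vertex e1 e2 k l \<in> K})
        \<longlonglongrightarrow> 0)"
proof
  interpret ball_weight_scheme e1 e2 L W
    using assms by unfold_locales auto
  show "\<exists>F. continuous_on UNIV F \<and>
    (bounded_edge_differences z0 \<longrightarrow>
      (\<lambda>k. sup_deviation e1 e2 (subdiv_data e1 e2 L W z0 k) F k UNIV) \<longlonglongrightarrow> 0) \<and>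
    (\<forall>K. compact K \<longrightarrow>
      (\<lambda>k. sup_deviation e1 e2 (subdiv_data e1 e2 L W z0 k) F k {l. grid_vertex e1 e2 k l \<in> K})
        \<longlonglongrightarrow> 0)" for z0
    by (rule convergence)
qed

end
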